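(* Let $\alpha_1,\alpha_2,\alpha_3$ be three non-collinear null points, and let $a$ be a point distinct from $\alpha_1,\alpha_2,\alpha_3$. Define the cevian points $$c_1\equiv(a\alpha_1)(\alpha_2\alpha_3),\qquad c_2\equiv(a\alpha_2)(\alpha_1\alpha_3),\qquad c_3\equiv(a\alpha_3)(\alpha_1\alpha_2),$$ and suppose that $c_1,c_2,c_3$ are non-null, so that their quadrea is defined. Then $$\mathcal A(c_1,c_2,c_3)=1.$$
   Context: Let $\mathbb F$ be a field of characteristic not two. A 3-proportion $x:y:z$ is a triple of elements of $\mathbb F$, not all zero, up to a common non-zero scalar. A point $a=[x:y:z]$ and a line $L=(l:m:n)$ are both 3-proportions. The point $[x:y:z]$ lies on the line $(l:m:n)$ when $lx+my-nz=0$. For distinct points $a,b$, the join $ab$ is the unique line through both; for distinct lines $L,M$, the meet $LM$ is the unique point lying on both. A point $[x:y:z]$ is null when $x^2+y^2-z^2=0$. The quadrea of three non-null points $a_i=[x_i:y_i:z_i]$, $i=1,2,3$, is $$\mathcal A(a_1,a_2,a_3)=-\frac{(x_1y_2z_3-x_1y_3z_2+x_2y_3z_1-x_3y_2z_1+x_3y_1z_2-x_2y_1z_3)^2}{(x_1^2+y_1^2-z_1^2)(x_2^2+y_2^2-z_2^2)(x_3^2+y_3^2-z_3^2)}.$$ *)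

theory Defs
  imports Main
begin

definition prop_rel :: "'a::field \<times> 'a \<times> 'a \<Rightarrow> 'a \<times> 'a \<times> 'a \<Rightarrow> bool" where
  "prop_rel = (\<lambda>(x, y, z) (x', y', z').
     (x, y, z) \<noteq> (0, 0, 0) \<and> (\<exists>c. c \<noteq> 0 \<and> x' = c * x \<and> y' = c * y \<and> z' = c * z))"

lemma prop_rel_refl: "t \<noteq> (0, 0, 0) \<Longrightarrow> prop_rel t t"
  by (cases t) (auto simp: prop_rel_def intro!: exI[of _ 1])

lemma prop_rel_sym: "prop_rel s t \<Longrightarrow> prop_rel t s"
  unfolding prop_rel_def
  apply (clarsimp split: prod.splits)
  subgoal for x y z c by (intro conjI exI[of _ "inverse c"]) auto
  done

lemma prop_rel_trans: "prop_rel s t \<Longrightarrow> prop_rel t u \<Longrightarrow> prop_rel s u"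
  unfolding prop_rel_def
  apply (clarsimp split: prod.splits)
  subgoal for x y z c d by (intro exI[of _ "d * c"]) auto
  done

text \<open>The relation is partial: the zero triple is related to nothing, so the quotient
  consists exactly of the classes of non-zero triples.\<close>

quotient_type (overloaded) 'a proportion = "'a::field \<times> 'a \<times> 'a" / partial: prop_rel
proof (rule part_equivpI)
  show "\<exists>t :: 'a \<times> 'a \<times> 'a. prop_rel t t"
    by (rule exI[of _ "(0, 0, 1)"]) (simp add: prop_rel_refl)
  show "symp (prop_rel :: 'a \<times> 'a \<times> 'a \<Rightarrow> _)" by (blast intro: sympI prop_rel_sym)
  show "transp (prop_rel :: 'a \<times> 'a \<times> 'a \<Rightarrow> _)" by (blast intro: transpI prop_rel_trans)
qed

type_synonym 'a point = "'a proportion"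
type_synonym 'a line = "'a proportion"

lift_definition lies_on :: "'a::field point \<Rightarrow> 'a line \<Rightarrow> bool" is
  "\<lambda>(x, y, z) (l, m, n). l * x + m * y - n * z = 0"
proof -
  fix s s' t t' :: "'a \<times> 'a \<times> 'a"
  assume "prop_rel s s'" "prop_rel t t'"
  moreover obtain x y z l m n where st: "s = (x, y, z)" "t = (l, m, n)" by (cases s, cases t)
  ultimately obtain c d where cd: "c \<noteq> 0" "d \<noteq> 0"
    and s': "s' = (c * x, c * y, c * z)" and t': "t' = (d * l, d * m, d * n)"
    by (auto simp: prop_rel_def)
  have "d * l * (c * x) + d * m * (c * y) - d * n * (c * z)
      = c * d * (l * x + m * y - n * z)" by algebra
  then show "?thesis s s' t t'"
    unfolding st s' t' prod.case using cd by (simp only: mult_eq_0_iff simp_thms)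
qed

text \<open>Joins and meets are unspecified when the two arguments coincide; otherwise existence and
  uniqueness are the lemmas \<open>ex1_join\<close> and \<open>ex1_meet\<close> below.\<close>

definition join :: "'a::field point \<Rightarrow> 'a point \<Rightarrow> 'a line" where
  "join a b = (THE L. lies_on a L \<and> lies_on b L)"

definition meet :: "'a::field line \<Rightarrow> 'a line \<Rightarrow> 'a point" where
  "meet L M = (THE a. lies_on a L \<and> lies_on a M)"

definition collinear :: "'a::field point \<Rightarrow> 'a point \<Rightarrow> 'a point \<Rightarrow> bool" where
  "collinear a b c \<longleftrightarrow> (\<exists>L. lies_on a L \<and> lies_on b L \<and> lies_on c L)"

lift_definition null_point :: "'a::field point \<Rightarrow> bool" is
  "\<lambda>(x, y, z). x\<^sup>2 + y\<^sup>2 - z\<^sup>2 = 0"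
proof -
  fix s s' :: "'a \<times> 'a \<times> 'a"
  assume "prop_rel s s'"
  moreover obtain x y z where s: "s = (x, y, z)" by (cases s)
  ultimately obtain c where c: "c \<noteq> 0" and s': "s' = (c * x, c * y, c * z)"
    by (auto simp: prop_rel_def)
  have "(c * x)\<^sup>2 + (c * y)\<^sup>2 - (c * z)\<^sup>2 = c\<^sup>2 * (x\<^sup>2 + y\<^sup>2 - z\<^sup>2)" by algebra
  then show "?thesis s s'"
    unfolding s s' prod.case using c by (simp only: mult_eq_0_iff power_eq_0_iff simp_thms)
qed

text \<open>Total by the convention that division by zero gives zero; the value is meaningful only
  when none of the three points is null.\<close>

lift_definition quadrea :: "'a::field point \<Rightarrow> 'a point \<Rightarrow> 'a point \<Rightarrow> 'a" is
  "\<lambda>(x1, y1, z1) (x2, y2, z2) (x3, y3, z3).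
     - ((x1 * y2 * z3 - x1 * y3 * z2 + x2 * y3 * z1 - x3 * y2 * z1 + x3 * y1 * z2 - x2 * y1 * z3)\<^sup>2
        / ((x1\<^sup>2 + y1\<^sup>2 - z1\<^sup>2) * (x2\<^sup>2 + y2\<^sup>2 - z2\<^sup>2) * (x3\<^sup>2 + y3\<^sup>2 - z3\<^sup>2)))"
proof -
  fix s s' t t' u u' :: "'a \<times> 'a \<times> 'a"
  assume "prop_rel s s'" "prop_rel t t'" "prop_rel u u'"
  moreover obtain x1 y1 z1 x2 y2 z2 x3 y3 z3
    where stu: "s = (x1, y1, z1)" "t = (x2, y2, z2)" "u = (x3, y3, z3)"
    by (cases s, cases t, cases u)
  ultimately obtain c d e where cde: "c \<noteq> 0" "d \<noteq> 0" "e \<noteq> 0"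
    and s': "s' = (c * x1, c * y1, c * z1)" and t': "t' = (d * x2, d * y2, d * z2)"
    and u': "u' = (e * x3, e * y3, e * z3)"
    by (auto simp: prop_rel_def)
  have num: "(c * x1 * (d * y2) * (e * z3) - c * x1 * (e * y3) * (d * z2)
        + d * x2 * (e * y3) * (c * z1) - e * x3 * (d * y2) * (c * z1)
        + e * x3 * (c * y1) * (d * z2) - d * x2 * (c * y1) * (e * z3))\<^sup>2
      = (c * d * e)\<^sup>2 * (x1 * y2 * z3 - x1 * y3 * z2 + x2 * y3 * z1 - x3 * y2 * z1
        + x3 * y1 * z2 - x2 * y1 * z3)\<^sup>2" by algebra
  have den: "((c * x1)\<^sup>2 + (c * y1)\<^sup>2 - (c * z1)\<^sup>2) * ((d * x2)\<^sup>2 + (d * y2)\<^sup>2 - (d * z2)\<^sup>2)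
        * ((e * x3)\<^sup>2 + (e * y3)\<^sup>2 - (e * z3)\<^sup>2)
      = (c * d * e)\<^sup>2 * ((x1\<^sup>2 + y1\<^sup>2 - z1\<^sup>2) * (x2\<^sup>2 + y2\<^sup>2 - z2\<^sup>2) * (x3\<^sup>2 + y3\<^sup>2 - z3\<^sup>2))"
    by algebra
  have nz: "(c * d * e)\<^sup>2 \<noteq> 0" using cde by simp
  show "?thesis s s' t t' u u'"
    unfolding stu s' t' u' prod.case num den mult_divide_mult_cancel_left[OF nz] ..
qed

lemma prop_rel_if_cross_eq_0:
  fixes x y z x' y' z' :: "'a::field"
  assumes nz: "(x, y, z) \<noteq> (0, 0, 0)" "(x', y', z') \<noteq> (0, 0, 0)"
    and cross: "y * z' = z * y'" "z * x' = x * z'" "x * y' = y * x'"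
  shows "prop_rel (x, y, z) (x', y', z')"
proof -
  obtain c where c: "x' = c * x" "y' = c * y" "z' = c * z"
  proof -
    consider "x \<noteq> 0" | "y \<noteq> 0" | "z \<noteq> 0" using nz(1) by auto
    then show thesis
    proof cases
      case 1
      then show ?thesis using cross by (intro that[of "x' / x"]) (simp_all add: field_simps)
    next
      case 2
      then show ?thesis using cross by (intro that[of "y' / y"]) (simp_all add: field_simps)
    next
      case 3
      then show ?thesis using cross by (intro that[of "z' / z"]) (simp_all add: field_simps)
    qed
  qed
  moreover have "c \<noteq> 0" using nz(2) c by auto
  ultimately show ?thesis using nz(1) by (auto simp: prop_rel_def)
qed

lemma ex_join:
  fixes a b :: "'a::field point"
  assumes "a \<noteq> b"
  shows "\<exists>L. lies_on a L \<and> lies_on b L"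
  using assms
proof (transfer, clarify)
  fix x y z x' y' z' :: 'a
  assume "prop_rel (x, y, z) (x, y, z)" "prop_rel (x', y', z') (x', y', z')"
    and neq: "\<not> prop_rel (x, y, z) (x', y', z')"
  then have nz: "(x, y, z) \<noteq> (0, 0, 0)" "(x', y', z') \<noteq> (0, 0, 0)"
    by (auto simp: prop_rel_def)
  let ?L = "(y * z' - z * y', z * x' - x * z', - (x * y' - y * x'))"
  have "?L \<noteq> (0, 0, 0)"
    using prop_rel_if_cross_eq_0[OF nz] neq by auto
  then have "prop_rel ?L ?L" by (rule prop_rel_refl)
  then show "\<exists>L\<in>Collect (\<lambda>L. prop_rel L L).
      (case L of (l, m, n) \<Rightarrow> l * x + m * y - n * z = 0)
      \<and> (case L of (l, m, n) \<Rightarrow> l * x' + m * y' - n * z' = 0)"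
    by (intro bexI[of _ ?L]) (auto simp: algebra_simps)
qed

lemma join_unique:
  fixes a b :: "'a::field point"
  assumes "a \<noteq> b" "lies_on a L" "lies_on b L" "lies_on a M" "lies_on b M"
  shows "L = M"
  using assms
proof (transfer, clarify)
  fix x y z x' y' z' l m n l' m' n' :: 'a
  assume "prop_rel (x, y, z) (x, y, z)" "prop_rel (x', y', z') (x', y', z')"
    and "prop_rel (l, m, n) (l, m, n)" "prop_rel (l', m', n') (l', m', n')"
    and neq: "\<not> prop_rel (x, y, z) (x', y', z')"
    and eqs: "l * x + m * y - n * z = 0" "l * x' + m * y' - n * z' = 0"
      "l' * x + m' * y - n' * z = 0" "l' * x' + m' * y' - n' * z' = 0"
  then have nz: "(x, y, z) \<noteq> (0, 0, 0)" "(x', y', z') \<noteq> (0, 0, 0)"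
    and nz': "(l, m, n) \<noteq> (0, 0, 0)" "(l', m', n') \<noteq> (0, 0, 0)"
    by (auto simp: prop_rel_def)
  have c: "(m * n' - n * m') * (y * z' - z * y') = 0" "(m * n' - n * m') * (z * x' - x * z') = 0"
    "(m * n' - n * m') * (x * y' - y * x') = 0" "(n * l' - l * n') * (y * z' - z * y') = 0"
    "(n * l' - l * n') * (z * x' - x * z') = 0" "(n * l' - l * n') * (x * y' - y * x') = 0"
    "(l * m' - m * l') * (y * z' - z * y') = 0" "(l * m' - m * l') * (z * x' - x * z') = 0"
    "(l * m' - m * l') * (x * y' - y * x') = 0"
    using eqs by algebra+
  have "y * z' - z * y' \<noteq> 0 \<or> z * x' - x * z' \<noteq> 0 \<or> x * y' - y * x' \<noteq> 0"
    using prop_rel_if_cross_eq_0[OF nz] neq by auto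
  with c have "m * n' - n * m' = 0" "n * l' - l * n' = 0" "l * m' - m * l' = 0"
    by (auto simp only: mult_eq_0_iff)
  then show "prop_rel (l, m, n) (l', m', n')"
    by (intro prop_rel_if_cross_eq_0[OF nz']) simp_all
qed

lemma ex1_join: "a \<noteq> b \<Longrightarrow> \<exists>!L. lies_on a L \<and> lies_on b L"
  using ex_join[of a b] join_unique[of a b] by blast

lemma lies_on_commute: "lies_on a L \<longleftrightarrow> lies_on L a"
  by transfer (auto simp: mult.commute split: prod.splits)

lemma ex1_meet: "L \<noteq> M \<Longrightarrow> \<exists>!a. lies_on a L \<and> lies_on a M"
  using ex1_join[of L M] by (simp add: lies_on_commute[of _ L] lies_on_commute[of _ M])

end

theory Submission
  imports Defs
begin

text \<open>
  Choose representing vectors \<open>v\<^sub>1, v\<^sub>2, v\<^sub>3\<close> of the null points. They form a basis, and by Cramer's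
  rule a multiple of \<open>a\<close> is \<open>k\<^sub>1 v\<^sub>1 + k\<^sub>2 v\<^sub>2 + k\<^sub>3 v\<^sub>3\<close>; hence the cevian points are
  \<open>k\<^sub>2 v\<^sub>2 + k\<^sub>3 v\<^sub>3\<close> and its two analogues. With \<open>B\<close> the bilinear form of \<open>x\<^sup>2 + y\<^sup>2 - z\<^sup>2\<close>, their
  determinant is \<open>2 k\<^sub>1 k\<^sub>2 k\<^sub>3 D\<close> with \<open>D = det (v\<^sub>1, v\<^sub>2, v\<^sub>3)\<close>, while the form takes the values
  \<open>2 k\<^sub>i k\<^sub>j B(v\<^sub>i, v\<^sub>j)\<close>. Finally, \<open>- D\<^sup>2\<close> is the Gram determinant of the \<open>v\<^sub>i\<close>, which reduces to
  \<open>2 B(v\<^sub>1, v\<^sub>2) B(v\<^sub>1, v\<^sub>3) B(v\<^sub>2, v\<^sub>3)\<close> because the \<open>v\<^sub>i\<close> are null.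
\<close>

type_synonym 'a triple = "'a \<times> 'a \<times> 'a"

definition lin_comb :: "'a::field \<Rightarrow> 'a triple \<Rightarrow> 'a \<Rightarrow> 'a triple \<Rightarrow> 'a triple" where
  "lin_comb s u t v = (case (u, v) of ((x, y, z), (x', y', z')) \<Rightarrow>
     (s * x + t * x', s * y + t * y', s * z + t * z'))"

text \<open>The polar form of the quadratic form that defines null points. Incidence carries the
  same signs, so this form also pairs points with lines.\<close>

definition inner3 :: "'a::field triple \<Rightarrow> 'a triple \<Rightarrow> 'a" where
  "inner3 u v = (case (u, v) of ((x, y, z), (x', y', z')) \<Rightarrow> x * x' + y * y' - z * z')"

definition det3 :: "'a::field triple \<Rightarrow> 'a triple \<Rightarrow> 'a triple \<Rightarrow> 'a" where
  "det3 u v w = (case (u, v, w) of ((x1, y1, z1), (x2, y2, z2), (x3, y3, z3)) \<Rightarrow>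
     x1 * y2 * z3 - x1 * y3 * z2 + x2 * y3 * z1 - x3 * y2 * z1 + x3 * y1 * z2 - x2 * y1 * z3)"

lemma det3_rotate: "det3 v w u = det3 u v w"
  by (simp add: det3_def algebra_simps split: prod.splits)

lemma lin_comb_commute: "lin_comb s u t v = lin_comb t v s u"
  by (simp add: lin_comb_def add.commute split: prod.splits)

lemma inner3_lin_comb_null:
  assumes "inner3 u u = 0" "inner3 v v = 0"
  shows "inner3 (lin_comb s u t v) (lin_comb s u t v) = 2 * s * t * inner3 u v"
  using assms unfolding inner3_def lin_comb_def
  by (induct u rule: prod_induct3; induct v rule: prod_induct3; simp only: prod.case; algebra)

text \<open>Determinants multiply, and the coefficient matrix with rows \<open>(0, k2, k3)\<close>,
  \<open>(k1, 0, k3)\<close>, \<open>(k1, k2, 0)\<close> has determinant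
  \<open>2 * k1 * k2 * k3\<close>.\<close>

lemma det3_cevians:
  "det3 (lin_comb k2 v k3 w) (lin_comb k1 u k3 w) (lin_comb k1 u k2 v)
    = 2 * k1 * k2 * k3 * det3 u v w"
  unfolding det3_def lin_comb_def
  by (induct u rule: prod_induct3; induct v rule: prod_induct3;
      induct w rule: prod_induct3; simp only: prod.case; algebra)

text \<open>The Gram matrix is V J V^T with J = diag(1, 1, -1), whose determinant is -1; the
  right-hand side expands this symmetric determinant.\<close>

lemma det3_square:
  "- (det3 u v w)\<^sup>2 = inner3 u u * inner3 v v * inner3 w w + 2 * inner3 u v * inner3 u w * inner3 v w
    - inner3 u u * (inner3 v w)\<^sup>2 - inner3 v v * (inner3 u w)\<^sup>2 - inner3 w w * (inner3 u v)\<^sup>2"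
  unfolding det3_def inner3_def
  by (induct u rule: prod_induct3; induct v rule: prod_induct3;
      induct w rule: prod_induct3; simp only: prod.case; algebra)

text \<open>Cramer's rule with denominators cleared. The coefficient \<open>1\<close> nests a sum of
  three terms; the coefficient \<open>0\<close> writes a scalar multiple.\<close>

lemma cramer:
  "lin_comb (det3 a v w) u 1 (lin_comb (det3 u a w) v (det3 u v a) w)
    = lin_comb (det3 u v w) a 0 u"
  unfolding det3_def lin_comb_def
  by (induct a rule: prod_induct3; induct u rule: prod_induct3; induct v rule: prod_induct3;
      induct w rule: prod_induct3;
      simp only: prod.case prod.inject; intro conjI; algebra)

lemma proportion_cases:
  fixes p :: "'a::field proportion"
  obtains v where "v \<noteq> (0, 0, 0)" "p = abs_proportion v"
proof -
  have "prop_rel (rep_proportion p) (rep_proportion p)" and "p = abs_proportion (rep_proportion p)"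
    using Quotient3_rep_reflp[OF Quotient3_proportion] Quotient3_abs_rep[OF Quotient3_proportion]
    by metis+
  then show thesis by (intro that[of "rep_proportion p"]) (auto simp: prop_rel_def)
qed

lemma lies_on_abs:
  assumes "v \<noteq> (0, 0, 0)" "l \<noteq> (0, 0, 0)"
  shows "lies_on (abs_proportion v) (abs_proportion l) \<longleftrightarrow> inner3 v l = 0"
  using assms by (subst lies_on.abs_eq)
    (auto simp: eq_onp_def prop_rel_refl inner3_def mult.commute split: prod.splits)

lemma null_point_abs:
  assumes "v \<noteq> (0, 0, 0)"
  shows "null_point (abs_proportion v) \<longleftrightarrow> inner3 v v = 0"
  using assms by (subst null_point.abs_eq)
    (auto simp: eq_onp_def prop_rel_refl inner3_def power2_eq_square split: prod.splits)

lemma quadrea_abs: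
  assumes "u \<noteq> (0, 0, 0)" "v \<noteq> (0, 0, 0)" "w \<noteq> (0, 0, 0)"
  shows "quadrea (abs_proportion u) (abs_proportion v) (abs_proportion w)
    = - ((det3 u v w)\<^sup>2 / (inner3 u u * inner3 v v * inner3 w w))"
  using assms by (subst quadrea.abs_eq)
    (auto simp: eq_onp_def prop_rel_refl inner3_def det3_def power2_eq_square split: prod.splits)

lemma abs_proportion_lin_comb_0:
  assumes "v \<noteq> (0, 0, 0)" "s \<noteq> 0"
  shows "abs_proportion (lin_comb s v 0 w) = abs_proportion v"
proof -
  have "prop_rel v (lin_comb s v 0 w)"
    using assms by (auto simp: prop_rel_def lin_comb_def split: prod.splits)
  then show ?thesis
    by (metis Quotient3_rel[OF Quotient3_proportion])
qed

lemma lin_comb_lies_on: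
  assumes "u \<noteq> (0, 0, 0)" "v \<noteq> (0, 0, 0)" "lin_comb s u t v \<noteq> (0, 0, 0)"
    and "lies_on (abs_proportion u) L" "lies_on (abs_proportion v) L"
  shows "lies_on (abs_proportion (lin_comb s u t v)) L"
proof -
  obtain l where l: "l \<noteq> (0, 0, 0)" "L = abs_proportion l" by (rule proportion_cases)
  have "inner3 (lin_comb s u t v) l = s * inner3 u l + t * inner3 v l"
    unfolding inner3_def lin_comb_def
    by (induct u rule: prod_induct3; induct v rule: prod_induct3;
      induct l rule: prod_induct3; simp only: prod.case; algebra)
  with assms l show ?thesis by (simp add: lies_on_abs)
qed

lemma join_commute: "join a b = join b a"
  by (simp add: join_def conj_commute)

lemma lies_on_join:
  assumes "a \<noteq> b"
  shows "lies_on a (join a b)" "lies_on b (join a b)"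
  using theI'[OF ex1_join[OF assms]] by (simp_all add: join_def)

lemma meet_eqI:
  assumes "L \<noteq> M" "lies_on p L" "lies_on p M"
  shows "meet L M = p"
  unfolding meet_def using ex1_meet[OF assms(1)] assms(2,3) by (intro the1_equality) auto

text \<open>Serves to draw a line through a single point by joining it to another. The line
  \<open>(1, 0, 0)\<close> separates two points, and no point equals both.\<close>

lemma ex_distinct_proportion: "\<exists>q. q \<noteq> (p :: 'a::field proportion)"
proof -
  have "\<not> lies_on (abs_proportion (1, 0, 0)) (abs_proportion (1, 0, 0) :: 'a proportion)"
    "lies_on (abs_proportion (0, 1, 0)) (abs_proportion (1, 0, 0) :: 'a proportion)"
    by (simp_all add: lies_on_abs inner3_def)
  then show ?thesis by metis
qed

text \<open>If two of the points coincided, a line through that point and the remaining one would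
  contain all three.\<close>

lemma not_collinear_distinct:
  fixes p q r :: "'a::field point"
  assumes "\<not> collinear p q r"
  shows "p \<noteq> q" "p \<noteq> r" "q \<noteq> r"
proof -
  have "\<exists>L. lies_on x L \<and> lies_on y L" for x y :: "'a point"
    using ex_join[of x y] ex_distinct_proportion[of x] ex_join by metis
  then show "p \<noteq> q" "p \<noteq> r" "q \<noteq> r"
    using assms unfolding collinear_def by metis+
qed

lemma det3_nonzero:
  assumes nz: "u \<noteq> (0, 0, 0)" "v \<noteq> (0, 0, 0)" "w \<noteq> (0, 0, 0)"
    and nc: "\<not> collinear (abs_proportion u) (abs_proportion v) (abs_proportion w)"
  shows "det3 u v w \<noteq> 0"
proof
  assume det: "det3 u v w = 0"
  obtain x'' y'' z'' where u: "u = (x'', y'', z'')" by (cases u)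
  obtain x y z where v: "v = (x, y, z)" by (cases v)
  obtain x' y' z' where w: "w = (x', y', z')" by (cases w)
  \<comment> \<open>The cross product of \<open>v\<close> and \<open>w\<close>, its last entry
    negated to offset the minus sign in \<open>inner3\<close>. Thus \<open>inner3 u ?l\<close> is
    \<open>det3 u v w\<close>.\<close>
  let ?l = "(y * z' - z * y', z * x' - x * z', y * x' - x * y')"
  have "\<not> prop_rel v w"
    using not_collinear_distinct(3)[OF nc] Quotient3_rel[OF Quotient3_proportion] by metis
  then have l: "?l \<noteq> (0, 0, 0)"
    using prop_rel_if_cross_eq_0 nz unfolding v w by fastforce
  have "inner3 u ?l = 0"
    using det unfolding u v w det3_def inner3_def prod.case by algebra
  moreover have "inner3 v ?l = 0" "inner3 w ?l = 0"
    unfolding v w inner3_def by (simp; algebra)+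
  ultimately show False
    using nc nz l lies_on_abs unfolding collinear_def by metis
qed

text \<open>By \<open>cramer\<close>, \<open>c\<close> is a combination of \<open>v\<close> and
  \<open>w\<close> and also of \<open>a\<close> and \<open>u\<close>, so its point lies on both
  lines.\<close>

lemma cevian_point:
  assumes nz: "a \<noteq> (0, 0, 0)" "u \<noteq> (0, 0, 0)" "v \<noteq> (0, 0, 0)" "w \<noteq> (0, 0, 0)"
    and nc: "\<not> collinear (abs_proportion u) (abs_proportion v) (abs_proportion w)"
    and neq: "abs_proportion a \<noteq> abs_proportion u"
  defines "c \<equiv> lin_comb (det3 u a w) v (det3 u v a) w"
  shows "c \<noteq> (0, 0, 0)"
    and "meet (join (abs_proportion a) (abs_proportion u)) (join (abs_proportion v) (abs_proportion w))
      = abs_proportion c"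
proof -
  let ?D = "det3 u v w" and ?k = "det3 a v w"
  have D: "?D \<noteq> 0" using det3_nonzero[OF nz(2-4) nc] .
  have cr: "lin_comb ?k u 1 c = lin_comb ?D a 0 u"
    unfolding c_def by (rule cramer)
  show c: "c \<noteq> (0, 0, 0)"
  proof
    \<comment> \<open>Otherwise \<open>a\<close> and \<open>u\<close> would have a common non-zero
      multiple and hence represent the same point.\<close>
    assume c0: "c = (0, 0, 0)"
    with cr have eq: "lin_comb ?k u 0 u = lin_comb ?D a 0 u"
      by (simp add: lin_comb_def split: prod.splits)
    moreover have "?k \<noteq> 0"
      using eq D nz(1) by (auto simp: lin_comb_def split: prod.splits)
    ultimately show False
      using neq nz D abs_proportion_lin_comb_0 by metis
  qed
  have ceq: "c = lin_comb ?D a (- ?k) u"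
    using cr by (auto simp: lin_comb_def algebra_simps split: prod.splits)
  note vw = not_collinear_distinct(3)[OF nc]
  show "meet (join (abs_proportion a) (abs_proportion u)) (join (abs_proportion v) (abs_proportion w))
      = abs_proportion c"
  proof (rule meet_eqI)
    show "join (abs_proportion a) (abs_proportion u) \<noteq> join (abs_proportion v) (abs_proportion w)"
      using lies_on_join[OF neq] lies_on_join[OF vw] nc unfolding collinear_def by metis
    show "lies_on (abs_proportion c) (join (abs_proportion a) (abs_proportion u))"
      using c lies_on_join[OF neq] nz unfolding ceq by (intro lin_comb_lies_on)
    show "lies_on (abs_proportion c) (join (abs_proportion v) (abs_proportion w))"
      using c lies_on_join[OF vw] nz unfolding c_def by (intro lin_comb_lies_on)
  qed
qed

lemma quadrea_cevians:
  assumes nz: "lin_comb k2 v k3 w \<noteq> (0, 0, 0)" "lin_comb k1 u k3 w \<noteq> (0, 0, 0)"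
      "lin_comb k1 u k2 v \<noteq> (0, 0, 0)"
    and null: "inner3 u u = 0" "inner3 v v = 0" "inner3 w w = 0"
    and nonnull: "\<not> null_point (abs_proportion (lin_comb k2 v k3 w))"
      "\<not> null_point (abs_proportion (lin_comb k1 u k3 w))"
      "\<not> null_point (abs_proportion (lin_comb k1 u k2 v))"
  shows "quadrea (abs_proportion (lin_comb k2 v k3 w)) (abs_proportion (lin_comb k1 u k3 w))
    (abs_proportion (lin_comb k1 u k2 v)) = 1"
proof -
  \<comment> \<open>The denominator of the quadrea. Scaling \<open>det3_square\<close> by
    \<open>(2 * k1 * k2 * k3)^2\<close> shows that the numerator square is
    \<open>- P\<close>.\<close>
  define P where
    "P = (2 * k2 * k3 * inner3 v w) * (2 * k1 * k3 * inner3 u w) * (2 * k1 * k2 * inner3 u v)"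
  have "P \<noteq> 0"
    using nonnull unfolding P_def null_point_abs[OF nz(1)] null_point_abs[OF nz(2)]
      null_point_abs[OF nz(3)] inner3_lin_comb_null[OF null(1,2)] inner3_lin_comb_null[OF null(1,3)]
      inner3_lin_comb_null[OF null(2,3)] by (simp only: mult_eq_0_iff simp_thms)
  moreover have "(2 * k1 * k2 * k3 * det3 u v w)\<^sup>2 = - P"
    using det3_square[of u v w] null unfolding P_def by algebra
  ultimately show ?thesis
    unfolding quadrea_abs[OF nz] det3_cevians inner3_lin_comb_null[OF null(1,2)]
      inner3_lin_comb_null[OF null(1,3)] inner3_lin_comb_null[OF null(2,3)] P_def[symmetric]
    by simp
qed

theorem theorem85:
  fixes \<alpha>\<^sub>1 \<alpha>\<^sub>2 \<alpha>\<^sub>3 a c\<^sub>1 c\<^sub>2 c\<^sub>3 :: "'a::field point"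
  assumes "CHAR('a) \<noteq> 2"
    and "null_point \<alpha>\<^sub>1" and "null_point \<alpha>\<^sub>2" and "null_point \<alpha>\<^sub>3"
    and "\<not> collinear \<alpha>\<^sub>1 \<alpha>\<^sub>2 \<alpha>\<^sub>3"
    and "a \<noteq> \<alpha>\<^sub>1" and "a \<noteq> \<alpha>\<^sub>2" and "a \<noteq> \<alpha>\<^sub>3"
    and "c\<^sub>1 = meet (join a \<alpha>\<^sub>1) (join \<alpha>\<^sub>2 \<alpha>\<^sub>3)"
    and "c\<^sub>2 = meet (join a \<alpha>\<^sub>2) (join \<alpha>\<^sub>1 \<alpha>\<^sub>3)"
    and "c\<^sub>3 = meet (join a \<alpha>\<^sub>3) (join \<alpha>\<^sub>1 \<alpha>\<^sub>2)"
    and "\<not> null_point c\<^sub>1" and "\<not> null_point c\<^sub>2" and "\<not> null_point c\<^sub>3"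
  shows "quadrea c\<^sub>1 c\<^sub>2 c\<^sub>3 = 1"
proof -
  obtain v1 where v1: "v1 \<noteq> (0, 0, 0)" "\<alpha>\<^sub>1 = abs_proportion v1" by (rule proportion_cases)
  obtain v2 where v2: "v2 \<noteq> (0, 0, 0)" "\<alpha>\<^sub>2 = abs_proportion v2" by (rule proportion_cases)
  obtain v3 where v3: "v3 \<noteq> (0, 0, 0)" "\<alpha>\<^sub>3 = abs_proportion v3" by (rule proportion_cases)
  obtain v where v: "v \<noteq> (0, 0, 0)" "a = abs_proportion v" by (rule proportion_cases)
  define k1 k2 k3 where k: "k1 = det3 v v2 v3" "k2 = det3 v1 v v3" "k3 = det3 v1 v2 v"
  note nc = assms(5)[unfolded v1 v2 v3]
  have nc2: "\<not> collinear (abs_proportion v2) (abs_proportion v3) (abs_proportion v1)"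
    and nc3: "\<not> collinear (abs_proportion v3) (abs_proportion v1) (abs_proportion v2)"
    using nc unfolding collinear_def by blast+
  have c1: "lin_comb k2 v2 k3 v3 \<noteq> (0, 0, 0)" "c\<^sub>1 = abs_proportion (lin_comb k2 v2 k3 v3)"
    using cevian_point[OF v(1) v1(1) v2(1) v3(1) nc] assms(6,9)
    unfolding v1(2) v2(2) v3(2) v(2) k by auto
  \<comment> \<open>Applying \<open>cevian_point\<close> to cyclic shifts of the vertices yields
    these determinants, which are rotations of the original three.\<close>
  have det: "det3 v2 v v1 = k3" "det3 v2 v3 v = k1" "det3 v3 v v2 = k1" "det3 v3 v1 v = k2"
    unfolding k by (metis det3_rotate)+
  \<comment> \<open>The cyclic shift puts the third vertex before the first, so the join and the
    combination are both swapped.\<close>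
  have c2: "lin_comb k1 v1 k3 v3 \<noteq> (0, 0, 0)" "c\<^sub>2 = abs_proportion (lin_comb k1 v1 k3 v3)"
    using cevian_point[OF v(1) v2(1) v3(1) v1(1) nc2] assms(7,10)
    unfolding v1(2) v2(2) v3(2) v(2) det
    by (auto simp: lin_comb_commute[of k3] join_commute[of "abs_proportion v3"])
  have c3: "lin_comb k1 v1 k2 v2 \<noteq> (0, 0, 0)" "c\<^sub>3 = abs_proportion (lin_comb k1 v1 k2 v2)"
    using cevian_point[OF v(1) v3(1) v1(1) v2(1) nc3] assms(8,11)
    unfolding v1(2) v2(2) v3(2) v(2) det by auto
  have null: "inner3 v1 v1 = 0" "inner3 v2 v2 = 0" "inner3 v3 v3 = 0"
    using assms(2-4) unfolding v1(2) v2(2) v3(2)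
    by (simp_all only: null_point_abs[OF v1(1)] null_point_abs[OF v2(1)] null_point_abs[OF v3(1)])
  show ?thesis
    using quadrea_cevians[OF c1(1) c2(1) c3(1) null] assms(12-14) unfolding c1(2) c2(2) c3(2) by blast
qed

end
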